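(* Let $n \geq 2$ and let $f \colon S^n \to \mathbb{R}$ be a $C^1$ function. Let $m_1, \dots, m_k \in S^n$ be pairwise distinct points, each of which is a (not necessarily strict) local minimum or local maximum of $f$, where $k \geq 3$. Then there exists $u \in S^n$, different from $m_1, \dots, m_k$, such that $Df(u) = 0$.
   Context: $S^n$ is the $n$-dimensional unit sphere, viewed as a smooth manifold with its standard differential structure, and $Df(u)$ denotes the total derivative (differential) of $f$ at $u$. *)

theory Defs
  imports "HOL-Analysis.Analysis"
begin

text \<open>
  The sphere \<open>S^n\<close> is \<open>sphere (0::'a) 1\<close> in a Euclidean space \<open>'a\<close> of dimension \<open>n + 1\<close>, with
  the smooth structure given by the stereographic charts. A function on \<open>S^n\<close> is a function
  on \<open>'a\<close> of which only the values on the unit sphere are used.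
\<close>

text \<open>
  \<open>stereo p\<close> is the inverse of stereographic projection from the pole \<open>p\<close>: for a unit vector
  \<open>p\<close> it maps the hyperplane orthogonal to \<open>p\<close> bijectively onto the unit sphere without \<open>p\<close>
  (see \<open>bij_betw_stereo\<close>).
\<close>

definition stereo :: "'a::euclidean_space \<Rightarrow> 'a \<Rightarrow> 'a" where
  "stereo p x = (1 / ((norm x)\<^sup>2 + 1)) *\<^sub>R (2 *\<^sub>R x + ((norm x)\<^sup>2 - 1) *\<^sub>R p)"

definition stereo_proj :: "'a::euclidean_space \<Rightarrow> 'a \<Rightarrow> 'a" where
  "stereo_proj p y = (1 / (1 - p \<bullet> y)) *\<^sub>R (y - (p \<bullet> y) *\<^sub>R p)"

text \<open>
  Derivatives within a hyperplane are determined only along the hyperplane. The values of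
  \<open>f'\<close> in the normal direction are thus irrelevant, as composing \<open>f'\<close> with the orthogonal
  projection shows.
\<close>

definition C1_on_sphere :: "('a::euclidean_space \<Rightarrow> real) \<Rightarrow> bool" where
  "C1_on_sphere f \<longleftrightarrow>
     (\<forall>p \<in> sphere 0 1. \<exists>f' :: 'a \<Rightarrow> 'a \<Rightarrow>\<^sub>L real.
        continuous_on {x. p \<bullet> x = 0} f' \<and>
        (\<forall>x. p \<bullet> x = 0 \<longrightarrow>
           ((f \<circ> stereo p) has_derivative blinfun_apply (f' x)) (at x within {x. p \<bullet> x = 0})))"

text \<open>
  The tangent space of the sphere at \<open>u\<close> is \<open>{v. u \<bullet> v = 0}\<close>. The differential of \<open>f\<close> at \<open>u\<close>
  is the linear functional \<open>D\<close> on it whose pullback along each chart \<open>stereo p\<close> is the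
  derivative of \<open>f \<circ> stereo p\<close>. Here \<open>D\<close> is a linear map on the whole space of which only the
  restriction to the tangent space matters, since the derivative of \<open>stereo p\<close> maps the
  hyperplane orthogonal to \<open>p\<close> onto the tangent space.
\<close>

definition has_sphere_derivative ::
    "('a::euclidean_space \<Rightarrow> real) \<Rightarrow> ('a \<Rightarrow> real) \<Rightarrow> 'a \<Rightarrow> bool" where
  "has_sphere_derivative f D u \<longleftrightarrow>
     linear D \<and>
     (\<forall>p \<in> sphere 0 1. \<forall>x. p \<bullet> x = 0 \<and> stereo p x = u \<longrightarrow>
        ((f \<circ> stereo p) has_derivative (\<lambda>h. D (frechet_derivative (stereo p) (at x) h)))
          (at x within {x. p \<bullet> x = 0}))"

definition local_min_on :: "'a::topological_space set \<Rightarrow> ('a \<Rightarrow> real) \<Rightarrow> 'a \<Rightarrow> bool" where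
  "local_min_on S f a \<longleftrightarrow> a \<in> S \<and> (\<forall>\<^sub>F x in at a within S. f a \<le> f x)"

definition local_max_on :: "'a::topological_space set \<Rightarrow> ('a \<Rightarrow> real) \<Rightarrow> 'a \<Rightarrow> bool" where
  "local_max_on S f a \<longleftrightarrow> a \<in> S \<and> (\<forall>\<^sub>F x in at a within S. f x \<le> f a)"

lemma norm_stereo:
  assumes "norm p = 1" "p \<bullet> x = 0"
  shows "norm (stereo p x) = 1"
proof -
  have p: "p \<bullet> p = 1" using assms(1) by (simp add: norm_eq_1)
  have nz: "x \<bullet> x + 1 > 0" using inner_ge_zero[of x] by linarith
  have xp: "x \<bullet> p = 0" using assms(2) by (simp add: inner_commute)
  have "(2 *\<^sub>R x + (x \<bullet> x - 1) *\<^sub>R p) \<bullet> (2 *\<^sub>R x + (x \<bullet> x - 1) *\<^sub>R p) = (x \<bullet> x + 1)\<^sup>2"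
    using p xp assms(2)
    by (simp add: inner_add_left inner_add_right power2_eq_square algebra_simps)
  then have "stereo p x \<bullet> stereo p x = 1"
    unfolding stereo_def power2_norm_eq_inner inner_scaleR_left inner_scaleR_right
    using nz by (simp add: power2_eq_square)
  then show ?thesis by (simp add: norm_eq_1)
qed

lemma inner_stereo:
  assumes "norm p = 1" "p \<bullet> x = 0"
  shows "p \<bullet> stereo p x = ((norm x)\<^sup>2 - 1) / ((norm x)\<^sup>2 + 1)"
  using assms by (simp add: stereo_def inner_add_right norm_eq_1)

lemma stereo_proj_stereo:
  assumes "norm p = 1" "p \<bullet> x = 0"
  shows "stereo_proj p (stereo p x) = x"
proof -
  define s where "s = (norm x)\<^sup>2"
  have s: "s + 1 > 0" unfolding s_def by (simp add: add_nonneg_pos)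
  have 1: "1 - (s - 1) / (s + 1) = 2 / (s + 1)"
    using s by (simp add: field_simps)
  have 2: "stereo p x - ((s - 1) / (s + 1)) *\<^sub>R p = (2 / (s + 1)) *\<^sub>R x"
    by (simp add: stereo_def s_def[symmetric] scaleR_add_right)
  have 3: "1 / (2 / (s + 1)) * (2 / (s + 1)) = 1"
    using s by simp
  show ?thesis
    unfolding stereo_proj_def inner_stereo[OF assms] s_def[symmetric] 1 2 scaleR_scaleR
    by (simp only: 3 scaleR_one)
qed

lemma stereo_stereo_proj:
  assumes "norm p = 1" "norm y = 1" "y \<noteq> p"
  shows "stereo p (stereo_proj p y) = y" and "p \<bullet> stereo_proj p y = 0"
proof -
  define c where "c = p \<bullet> y"
  have p: "p \<bullet> p = 1" and y: "y \<bullet> y = 1" using assms by (simp_all add: norm_eq_1)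
  have "(y - p) \<bullet> (y - p) > 0" using assms(3) by simp
  then have c: "c < 1"
    using p y by (simp add: c_def inner_diff_left inner_diff_right inner_commute)
  show "p \<bullet> stereo_proj p y = 0"
    using p by (simp add: stereo_proj_def inner_diff_right)
  have "(y - c *\<^sub>R p) \<bullet> (y - c *\<^sub>R p) = 1 - c\<^sup>2"
    using p y
    by (simp add: c_def inner_diff_left inner_diff_right inner_commute power2_eq_square algebra_simps)
  then have "(norm (stereo_proj p y))\<^sup>2 = (1 - c\<^sup>2) / (1 - c)\<^sup>2"
    unfolding stereo_proj_def c_def[symmetric] power2_norm_eq_inner
    by (simp only: inner_scaleR_left inner_scaleR_right) (simp add: power2_eq_square)
  also have "\<dots> = (1 + c) / (1 - c)"
  proof -
    have "1 - c\<^sup>2 = (1 + c) * (1 - c)" by (simp add: power2_eq_square algebra_simps)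
    then show ?thesis using c by (simp add: power2_eq_square)
  qed
  finally have s: "(norm (stereo_proj p y))\<^sup>2 = (1 + c) / (1 - c)" .
  have a: "(1 + c) / (1 - c) + 1 = 2 / (1 - c)" and b: "(1 + c) / (1 - c) - 1 = 2 * c / (1 - c)"
    using c by (simp_all add: field_simps)
  have "stereo p (stereo_proj p y)
      = ((1 - c) / 2) *\<^sub>R ((2 / (1 - c)) *\<^sub>R (y - c *\<^sub>R p) + (2 * c / (1 - c)) *\<^sub>R p)"
    unfolding stereo_def s a b by (simp add: stereo_proj_def c_def[symmetric])
  also have "\<dots> = ((1 - c) / 2 * (2 / (1 - c))) *\<^sub>R (y - c *\<^sub>R p)
      + ((1 - c) / 2 * (2 * c / (1 - c))) *\<^sub>R p"
    by (simp only: scaleR_add_right scaleR_scaleR)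
  also have "(1 - c) / 2 * (2 / (1 - c)) = 1" using c by simp
  also have "(1 - c) / 2 * (2 * c / (1 - c)) = c" using c by simp
  also have "1 *\<^sub>R (y - c *\<^sub>R p) + c *\<^sub>R p = y" by simp
  finally show "stereo p (stereo_proj p y) = y" .
qed

lemma bij_betw_stereo:
  assumes "norm p = 1"
  shows "bij_betw (stereo p) {x. p \<bullet> x = 0} (sphere 0 1 - {p})"
proof (rule bij_betw_byWitness[where f' = "stereo_proj p"])
  show "stereo p ` {x. p \<bullet> x = 0} \<subseteq> sphere 0 1 - {p}"
  proof clarify
    fix x assume x: "p \<bullet> x = 0"
    have "p \<bullet> stereo p x \<noteq> 1"
      unfolding inner_stereo[OF assms x] by (simp add: divide_eq_eq)
    then have "stereo p x \<noteq> p" using assms by (auto simp: norm_eq_1)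
    then show "stereo p x \<in> sphere 0 1 - {p}" using norm_stereo[OF assms x] by simp
  qed
qed (use assms in \<open>auto simp: stereo_proj_stereo stereo_stereo_proj\<close>)

lemma stereo_differentiable: "stereo p differentiable at x"
proof -
  have "(norm x)\<^sup>2 + 1 > 0" by (simp add: add_nonneg_pos)
  then have "x \<bullet> x + 1 \<noteq> 0" by (simp add: power2_norm_eq_inner)
  then have "\<exists>D. ((\<lambda>x. (1 / (x \<bullet> x + 1)) *\<^sub>R (2 *\<^sub>R x + (x \<bullet> x - 1) *\<^sub>R p)) has_derivative D) (at x)"
    by (intro exI) (rule derivative_eq_intros refl | assumption)+
  then show ?thesis
    unfolding stereo_def differentiable_def power2_norm_eq_inner by blast
qed

text \<open>
  The chart-based differential agrees with the derivative within the sphere as a subset of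
  the ambient space.
\<close>

lemma has_sphere_derivative_iff:
  assumes u: "norm u = 1"
  shows "has_sphere_derivative f D u \<longleftrightarrow> (f has_derivative D) (at u within sphere 0 1)"
proof
  assume D: "(f has_derivative D) (at u within sphere 0 1)"
  show "has_sphere_derivative f D u"
    unfolding has_sphere_derivative_def
  proof (intro conjI ballI allI impI; (elim conjE)?)
    show "linear D" using D by (rule has_derivative_linear)
  next
    fix p x :: 'a assume p: "p \<in> sphere 0 1" and x: "p \<bullet> x = 0" "stereo p x = u"
    have sub: "stereo p ` {x. p \<bullet> x = 0} \<subseteq> sphere 0 1"
      using p norm_stereo by auto
    have "(stereo p has_derivative frechet_derivative (stereo p) (at x)) (at x)"
      using stereo_differentiable frechet_derivative_works by blast
    then have 1: "(stereo p has_derivative frechet_derivative (stereo p) (at x))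
        (at x within {x. p \<bullet> x = 0})"
      by (rule has_derivative_at_withinI)
    have 2: "(f has_derivative D) (at (stereo p x) within stereo p ` {x. p \<bullet> x = 0})"
      using has_derivative_subset[OF D sub] x by simp
    show "((f \<circ> stereo p) has_derivative (\<lambda>h. D (frechet_derivative (stereo p) (at x) h)))
        (at x within {x. p \<bullet> x = 0})"
      using diff_chain_within[OF 1 2] by (simp add: o_def)
  qed
next
  assume D: "has_sphere_derivative f D u"
  define P where "P = stereo_proj (- u)"
  let ?T = "{x. (- u) \<bullet> x = 0}"
  have uu: "u \<bullet> u = 1" using u by (simp add: norm_eq_1)
  have un: "u \<noteq> - u"
  proof
    assume "u = - u"
    then have "u \<bullet> u = - (u \<bullet> u)" by (metis inner_minus_left)
    then show False using uu by simp
  qed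
  have lin: "linear D" using D by (simp add: has_sphere_derivative_def)
  have "(stereo (- u) has_derivative (\<lambda>h. 2 *\<^sub>R h)) (at 0)"
    unfolding stereo_def power2_norm_eq_inner
    by (auto intro!: derivative_eq_intros)
  then have d0: "frechet_derivative (stereo (- u)) (at 0) = (\<lambda>h. 2 *\<^sub>R h)"
    by (rule frechet_derivative_at[symmetric])
  have "stereo (- u) 0 = u" by (simp add: stereo_def)
  then have 1: "((f \<circ> stereo (- u)) has_derivative (\<lambda>h. D (2 *\<^sub>R h))) (at 0 within ?T)"
    using D u unfolding has_sphere_derivative_def by (metis d0 inner_zero_right mem_sphere_0 norm_minus_cancel)
  have P0: "P u = 0" using uu by (simp add: P_def stereo_proj_def)
  have 2: "(P has_derivative (\<lambda>h. (1/2) *\<^sub>R (h - (u \<bullet> h) *\<^sub>R u))) (at u within sphere 0 1 - {- u})"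
    unfolding P_def stereo_proj_def using uu
    by (auto intro!: derivative_eq_intros)
  have img: "P ` (sphere 0 1 - {- u}) \<subseteq> ?T"
    using u stereo_stereo_proj(2)[of "- u"] by (auto simp: P_def)
  have "((f \<circ> stereo (- u)) has_derivative (\<lambda>h. D (2 *\<^sub>R h))) (at (P u) within P ` (sphere 0 1 - {- u}))"
    using has_derivative_subset[OF 1 img] P0 by simp
  from diff_chain_within[OF 2 this]
  have "((f \<circ> stereo (- u) \<circ> P) has_derivative (\<lambda>h. D (h - (u \<bullet> h) *\<^sub>R u)))
      (at u within sphere 0 1 - {- u})"
    by (simp add: o_def)
  then have 3: "(f has_derivative (\<lambda>h. D (h - (u \<bullet> h) *\<^sub>R u))) (at u within sphere 0 1 - {- u})"
  proof (rule has_derivative_transform[rotated 2])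
    show "u \<in> sphere 0 1 - {- u}" using u un by auto
    show "\<And>x. x \<in> sphere 0 1 - {- u} \<Longrightarrow> f x = (f \<circ> stereo (- u) \<circ> P) x"
      using u stereo_stereo_proj(1)[of "- u"] by (auto simp: P_def)
  qed
  have "at u within sphere 0 1 - {- u} = at u within sphere 0 1"
    using un by (intro at_within_nhd[of _ "- {- u}"]) auto
  with 3 have 3: "(f has_derivative (\<lambda>h. D (h - (u \<bullet> h) *\<^sub>R u))) (at u within sphere 0 1)" by simp
  have "((\<lambda>y. - (1/2) * ((y - u) \<bullet> (y - u)) + 1) has_derivative (\<lambda>h. 0)) (at u within sphere 0 1)"
    by (auto intro!: derivative_eq_intros)
  then have 4: "((\<lambda>y. u \<bullet> y) has_derivative (\<lambda>h. 0)) (at u within sphere 0 1)"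
  proof (rule has_derivative_transform[rotated 2])
    show "u \<in> sphere 0 1" using u by simp
    show "\<And>x. x \<in> sphere 0 1 \<Longrightarrow> u \<bullet> x = - (1/2) * ((x - u) \<bullet> (x - u)) + 1"
      using uu by (auto simp: norm_eq_1 inner_diff_left inner_diff_right inner_commute diff_divide_distrib)
  qed
  have 5: "((\<lambda>y. u \<bullet> y) has_derivative (\<lambda>h. u \<bullet> h)) (at u within sphere 0 1)"
    by (auto intro!: derivative_eq_intros)
  have "((\<lambda>y. f y + D u * (u \<bullet> y - u \<bullet> y)) has_derivative
      (\<lambda>h. D (h - (u \<bullet> h) *\<^sub>R u) + D u * (u \<bullet> h - 0))) (at u within sphere 0 1)"
    by (intro has_derivative_add has_derivative_mult_right has_derivative_diff 3 4 5)
  then show "(f has_derivative D) (at u within sphere 0 1)"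
    by (simp add: linear_diff[OF lin] linear_cmul[OF lin] mult.commute)
qed

end

theory Submission
  imports Defs
begin

text \<open>
  Suppose that the only critical points of \<open>f\<close> are the given extrema. They are isolated, so all of
  them are strict: a neighbour of a local minimum with the same value would be a local
  minimum too, hence critical. Among three extrema two are of the same kind; passing to \<open>- f\<close> if
  necessary, let \<open>a\<close> and \<open>b\<close> be two strict local minima. A mountain pass argument that uses
  only connectedness, and no gradient flow (for a \<open>C\<^sup>1\<close> function the gradient need not have one),
  yields a contradiction.

  Let \<open>c\<close> be the least level such that a connected subset \<open>K\<close> of \<open>{f \<le> c}\<close> contains \<open>a\<close> and \<open>b\<close>
  (\<open>minimax_continuum\<close>), and let \<open>U\<close> be the component of \<open>a\<close> in the open set \<open>{f < c}\<close>. By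
  minimality \<open>b\<close> is not in \<open>U\<close>, so \<open>K\<close> has to leave the closure of \<open>U\<close> somewhere. A boundary point
  \<open>x\<close> of \<open>U\<close> lies on the level \<open>c\<close>, and \<open>K\<close> can leave the closure of \<open>U\<close> at \<open>x\<close> only if \<open>{f < c}\<close>
  has several components near \<open>x\<close> or if \<open>{f \<le> c}\<close> is not the closure of \<open>{f < c}\<close> near \<open>x\<close>. No
  point of the sphere allows this (\<open>mountain_pass\<close>):
  \<^item> near a noncritical point \<open>{f < c}\<close> is connected, because all its points can be pushed along a
    common direction of descent into one small ball (\<open>noncritical_sublevel_locally_connected\<close>),
    and every point of the level set can be pushed into it (\<open>noncritical_in_closure_sublevel\<close>);
  \<^item> near a strict local maximum \<open>{f < c}\<close> is a punctured neighbourhood, which is connected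
    since the sphere has dimension at least two (\<open>sphere_punctured_nbhd\<close>); this is where the
    theorem would fail on the circle;
  \<^item> a strict local minimum on the level \<open>c\<close> is not in the closure of \<open>{f < c}\<close>.
\<close>

section \<open>Components of strict sublevel sets\<close>

lemma openin_strict_sublevel:
  fixes f :: "'a::topological_space \<Rightarrow> real"
  assumes "continuous_on S f"
  shows "openin (top_of_set S) {x \<in> S. f x < c}"
  using continuous_openin_preimage_gen[OF assms open_lessThan[of c]]
  by (simp add: vimage_def Int_def)

lemma openin_component_strict_sublevel:
  fixes f :: "'a::metric_space \<Rightarrow> real"
  assumes "locally path_connected S" "continuous_on S f"
  shows "openin (top_of_set S) (connected_component_set {x \<in> S. f x < c} a)"
proof -
  have o: "openin (top_of_set S) {x \<in> S. f x < c}" by (rule openin_strict_sublevel[OF assms(2)])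
  have "locally connected {x \<in> S. f x < c}"
    by (intro locally_path_connected_imp_locally_connected locally_open_subset[OF assms(1) o])
  then have "openin (top_of_set {x \<in> S. f x < c}) (connected_component_set {x \<in> S. f x < c} a)"
    by (rule openin_connected_component_locally_connected)
  then show ?thesis using o openin_trans by blast
qed

text \<open>
  In a component of an open sublevel set two points are joined by a path, and a path is compact,
  so \<open>f\<close> attains its maximum there. This is how leaving room below the level \<open>c\<close> is gained.
\<close>

lemma component_strict_sublevel_joined_below:
  fixes f :: "'a::metric_space \<Rightarrow> real"
  assumes lpc: "locally path_connected S" and cont: "continuous_on S f"
    and b: "b \<in> connected_component_set {x \<in> S. f x < c} a"
  shows "\<exists>C t. t < c \<and> connected C \<and> C \<subseteq> {x \<in> S. f x \<le> t} \<and> a \<in> C \<and> b \<in> C"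
proof -
  have "locally path_connected {x \<in> S. f x < c}"
    by (rule locally_open_subset[OF lpc openin_strict_sublevel[OF cont]])
  then have "path_component {x \<in> S. f x < c} a b"
    using b path_component_eq_connected_component by (metis mem_Collect_eq)
  then obtain g where g: "path g" "path_image g \<subseteq> {x \<in> S. f x < c}" "pathstart g = a" "pathfinish g = b"
    unfolding path_component_def by blast
  have "compact (path_image g)" "path_image g \<noteq> {}" "continuous_on (path_image g) f"
    using g cont by (auto simp: compact_path_image intro: continuous_on_subset)
  then obtain x where x: "x \<in> path_image g" "\<forall>y\<in>path_image g. f y \<le> f x"
    by (metis continuous_attains_sup)
  show ?thesis
  proof (intro exI conjI)
    show "f x < c" using x g by auto
    show "connected (path_image g)" using g by (simp add: connected_path_image)
    show "path_image g \<subseteq> {y \<in> S. f y \<le> f x}" using x g by auto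
    show "a \<in> path_image g" "b \<in> path_image g" using g by auto
  qed
qed

section \<open>The minimax level\<close>

text \<open>
  The level \<open>c\<close> is the infimum of all \<open>t\<close> for which some connected subset of \<open>{f \<le> t}\<close> contains
  \<open>a\<close> and \<open>b\<close>. The infimum is attained: the components of \<open>a\<close> in the sets \<open>{f \<le> c + 1/(n+1)}\<close> form
  a decreasing sequence of continua, and the intersection of such a sequence is connected. For
  paths in place of connected sets this compactness would fail.
\<close>

lemma minimax_continuum:
  fixes f :: "'a::euclidean_space \<Rightarrow> real"
  assumes S: "compact S" "connected S" and cont: "continuous_on S f"
    and ab: "a \<in> S" "b \<in> S"
  obtains K c where "connected K" "K \<subseteq> {x \<in> S. f x \<le> c}" "a \<in> K" "b \<in> K"
    and "\<not> (\<exists>C t. t < c \<and> connected C \<and> C \<subseteq> {x \<in> S. f x \<le> t} \<and> a \<in> C \<and> b \<in> C)"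
proof -
  define T where "T = {t. \<exists>C. connected C \<and> C \<subseteq> {x \<in> S. f x \<le> t} \<and> a \<in> C \<and> b \<in> C}"
  define c where "c = Inf T"
  obtain z where "z \<in> S" "\<forall>y\<in>S. f y \<le> f z"
    using continuous_attains_sup[OF S(1) _ cont] ab by blast
  then have "f z \<in> T" unfolding T_def using S ab by blast
  then have ne: "T \<noteq> {}" by blast
  have bdd: "bdd_below T" by (rule bdd_belowI[of _ "f a"]) (auto simp: T_def)
  define K where "K n = connected_component_set {x \<in> S. f x \<le> c + 1 / real (Suc n)} a" for n
  have comp: "compact {x \<in> S. f x \<le> t}" for t
  proof -
    have "closed {x \<in> S. f x \<le> t}"
      by (rule continuous_on_closed_Collect_le[OF cont continuous_on_const compact_imp_closed[OF S(1)]])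
    from compact_Int_closed[OF S(1) this] show ?thesis by (simp add: Int_def)
  qed
  have Kb: "b \<in> K n" and Ka: "a \<in> K n" for n
  proof -
    have "\<exists>t\<in>T. t < c + 1 / real (Suc n)"
      using cInf_lessD[OF ne, of "c + 1 / real (Suc n)"] by (simp add: c_def)
    then obtain t C where "t < c + 1 / real (Suc n)" and C: "connected C" "C \<subseteq> {x \<in> S. f x \<le> t}" "a \<in> C" "b \<in> C"
      unfolding T_def by blast
    then have "C \<subseteq> K n" unfolding K_def
      by (intro connected_component_maximal) auto
    then show "b \<in> K n" "a \<in> K n" using C by auto
  qed
  have "connected (\<Inter>(range K))"
  proof (rule connected_nest)
    show "compact (K n)" for n
    proof -
      let ?A = "{x \<in> S. f x \<le> c + 1 / real (Suc n)}"
      have "?A \<inter> K n = K n" unfolding K_def using connected_component_subset by blast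
      moreover have "closed (K n)"
        unfolding K_def by (rule closed_connected_component[OF compact_imp_closed[OF comp]])
      ultimately show ?thesis using compact_Int_closed[OF comp, of "K n"] by metis
    qed
    show "connected (K n)" for n by (simp add: K_def)
    show "K n \<subseteq> K m" if "m \<le> n" for m n
    proof -
      have "1 / real (Suc n) \<le> 1 / real (Suc m)" using that by (simp add: frac_le)
      then show ?thesis unfolding K_def by (intro connected_component_mono) force
    qed
  qed
  moreover have "\<Inter>(range K) \<subseteq> {x \<in> S. f x \<le> c}"
  proof
    fix x assume "x \<in> \<Inter>(range K)"
    then have x: "x \<in> S \<and> f x \<le> c + 1 / real (Suc n)" for n
      using connected_component_subset[of "{x \<in> S. f x \<le> c + 1 / real (Suc n)}" a] by (auto simp: K_def)
    have "(\<lambda>n. c + 1 / real (Suc n)) \<longlonglongrightarrow> c + 0"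
      by (intro tendsto_add tendsto_const LIMSEQ_Suc[OF lim_1_over_n])
    then have "f x \<le> c" using x by (intro LIMSEQ_le_const[where X = "\<lambda>n. c + 1 / real (Suc n)"]) auto
    then show "x \<in> {x \<in> S. f x \<le> c}" using x by auto
  qed
  moreover have "a \<in> \<Inter>(range K)" "b \<in> \<Inter>(range K)" using Ka Kb by auto
  moreover have "\<not> (\<exists>C t. t < c \<and> connected C \<and> C \<subseteq> {x \<in> S. f x \<le> t} \<and> a \<in> C \<and> b \<in> C)"
  proof -
    have "c \<le> t" if "t \<in> T" for t unfolding c_def by (intro cInf_lower that bdd)
    then show ?thesis unfolding T_def by (auto simp: not_less[symmetric])
  qed
  ultimately show thesis by (rule that)
qed

section \<open>A topological mountain pass theorem\<close>

definition strict_local_min_on :: "'a::topological_space set \<Rightarrow> ('a \<Rightarrow> real) \<Rightarrow> 'a \<Rightarrow> bool" where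
  "strict_local_min_on S f x \<longleftrightarrow>
    (\<exists>N. open N \<and> x \<in> N \<and> (\<forall>y \<in> N \<inter> S. y \<noteq> x \<longrightarrow> f x < f y))"

text \<open>
  This is the local property of regular points and of strict local maxima that the mountain
  pass argument needs: \<open>x\<close> does not separate the sublevel set below it, nor does \<open>{f \<le> f x}\<close>
  have any piece near \<open>x\<close> that does not border on \<open>{f < f x}\<close>. The connected set \<open>C\<close> may
  be larger than the neighbourhood \<open>N\<close>, which makes the property easier to verify and
  no less useful, as only the component of \<open>{f < f x}\<close> matters.
\<close>

definition sublevel_unsplit_at :: "'a::topological_space set \<Rightarrow> ('a \<Rightarrow> real) \<Rightarrow> 'a \<Rightarrow> bool" where
  "sublevel_unsplit_at S f x \<longleftrightarrow>
    (\<exists>N C. open N \<and> x \<in> N \<and> connected C \<and> C \<subseteq> {y \<in> S. f y < f x} \<and>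
       N \<inter> {y \<in> S. f y < f x} \<subseteq> C \<and> N \<inter> {y \<in> S. f y \<le> f x} \<subseteq> closure {y \<in> S. f y < f x})"

text \<open>
  A strict local minimum \<open>a\<close> is an isolated point of \<open>{f \<le> f a}\<close>. This puts the minimax level of two
  distinct strict local minima strictly above both of their values.
\<close>

lemma connected_sublevel_imp_eq_strict_local_min:
  fixes f :: "'a::t1_space \<Rightarrow> real"
  assumes "connected K" "K \<subseteq> {x \<in> S. f x \<le> c}" "a \<in> K" "b \<in> K"
    and "strict_local_min_on S f a" "c \<le> f a"
  shows "b = a"
proof -
  obtain N where N: "open N" "a \<in> N" "\<forall>y \<in> N \<inter> S. y \<noteq> a \<longrightarrow> f a < f y"
    using assms(5) unfolding strict_local_min_on_def by blast
  have "K \<inter> N = {a}" using N assms by force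
  then have "openin (top_of_set K) {a}" using N(1) by (metis openin_open)
  moreover have "closedin (top_of_set K) {a}" using assms(3) by (simp add: closed_subset)
  ultimately have "K = {a}" using assms(1) unfolding connected_clopen by blast
  then show ?thesis using assms(4) by simp
qed

text \<open>
  If there were two strict local minima \<open>a\<close> and \<open>b\<close>, then for the minimax continuum \<open>K\<close> and the
  component \<open>U\<close> of \<open>a\<close> in \<open>{f < c}\<close> the set \<open>K \<inter> closure U\<close> would be open and closed in \<open>K\<close>. As
  it contains \<open>a\<close>, it would contain \<open>b\<close>. But a limit point of \<open>U\<close> below the level \<open>c\<close> belongs to \<open>U\<close>,
  so \<open>a\<close> and \<open>b\<close> would already be joined at a level below \<open>c\<close>.
\<close>

lemma mountain_pass:
  fixes f :: "'a::euclidean_space \<Rightarrow> real"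
  assumes S: "compact S" "connected S" "locally path_connected S" and cont: "continuous_on S f"
    and alt: "\<And>x. x \<in> S \<Longrightarrow> strict_local_min_on S f x \<or> sublevel_unsplit_at S f x"
    and a: "a \<in> S" "strict_local_min_on S f a" and b: "b \<in> S" "strict_local_min_on S f b"
  shows "a = b"
proof (rule ccontr)
  assume ne: "a \<noteq> b"
  obtain K c where K: "connected K" "K \<subseteq> {x \<in> S. f x \<le> c}" "a \<in> K" "b \<in> K"
    and least: "\<not> (\<exists>C t. t < c \<and> connected C \<and> C \<subseteq> {x \<in> S. f x \<le> t} \<and> a \<in> C \<and> b \<in> C)"
    by (rule minimax_continuum[OF S(1,2) cont a(1) b(1)])
  have fa: "f a < c" and fb: "f b < c"
    using connected_sublevel_imp_eq_strict_local_min[OF K(1,2,3,4) a(2)]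
      connected_sublevel_imp_eq_strict_local_min[OF K(1,2,4,3) b(2)] ne by force+
  let ?L = "{x \<in> S. f x < c}"
  define U where "U = connected_component_set ?L a"
  have UL: "U \<subseteq> ?L" by (simp add: U_def connected_component_subset)
  have aU: "a \<in> U" using a fa by (simp add: U_def)
  have bU: "b \<notin> U"
    using component_strict_sublevel_joined_below[OF S(3) cont, of b c a] least
    unfolding U_def by blast
  have absorb: "C \<subseteq> U" if C: "connected C" "C \<subseteq> ?L" "C \<inter> U \<noteq> {}" for C
  proof -
    obtain z where z: "z \<in> C" "z \<in> U" using C(3) by blast
    then have "C \<subseteq> connected_component_set ?L z" using C by (intro connected_component_maximal)
    also have "\<dots> = U" using z(2) unfolding U_def by (rule connected_component_eq)
    finally show ?thesis .
  qed
  have low: "x \<in> U" if x: "x \<in> closure U" "x \<in> ?L" for x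
  proof -
    let ?V = "connected_component_set ?L x"
    have "openin (top_of_set S) ?V" by (rule openin_component_strict_sublevel[OF S(3) cont])
    then obtain W where W: "open W" "?V = S \<inter> W" by (auto simp: openin_open)
    have xV: "x \<in> ?V" using x by simp
    then have "W \<inter> U \<noteq> {}" using x W open_Int_closure_eq_empty[of W U] by blast
    then have "?V \<inter> U \<noteq> {}" using W UL by blast
    then have "?V \<subseteq> U" by (intro absorb) (auto simp: connected_component_subset)
    then show ?thesis using xV by blast
  qed
  have nbhd: "\<exists>N. open N \<and> x \<in> N \<and> K \<inter> N \<subseteq> closure U" if x: "x \<in> K" "x \<in> closure U" for x
  proof (cases "f x < c")
    case True
    then have "x \<in> U" using low x K by blast
    moreover have "openin (top_of_set S) U"
      unfolding U_def by (rule openin_component_strict_sublevel[OF S(3) cont])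
    ultimately obtain W where W: "open W" "x \<in> W" "U = S \<inter> W" by (auto simp: openin_open)
    have "K \<inter> W \<subseteq> closure U" using W K closure_subset[of U] by blast
    then show ?thesis using W by blast
  next
    case False
    then have fx: "f x = c" and xS: "x \<in> S" using x K by force+
    have meets: "N \<inter> U \<noteq> {}" if "open N" "x \<in> N" for N
      using that x open_Int_closure_eq_empty[of N U] by blast
    have "\<not> strict_local_min_on S f x"
    proof
      assume "strict_local_min_on S f x"
      then obtain N where N: "open N" "x \<in> N" "\<forall>y \<in> N \<inter> S. y \<noteq> x \<longrightarrow> f x < f y"
        unfolding strict_local_min_on_def by blast
      obtain y where "y \<in> N" "y \<in> U" using meets[OF N(1,2)] by blast
      then show False using N UL fx by force
    qed
    then have "sublevel_unsplit_at S f x" using alt xS by blast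
    then obtain N C where N: "open N" "x \<in> N" and C: "connected C" "C \<subseteq> ?L" "N \<inter> ?L \<subseteq> C"
      and cl: "N \<inter> {y \<in> S. f y \<le> c} \<subseteq> closure ?L"
      unfolding sublevel_unsplit_at_def fx by blast
    have "C \<inter> U \<noteq> {}" using meets[OF N] C UL by blast
    then have "C \<subseteq> U" using absorb C by blast
    have "K \<inter> N \<subseteq> N \<inter> closure ?L" using cl K by blast
    also have "\<dots> \<subseteq> closure (N \<inter> ?L)" by (rule open_Int_closure_subset[OF N(1)])
    also have "\<dots> \<subseteq> closure U" using C \<open>C \<subseteq> U\<close> by (intro closure_mono) blast
    finally show ?thesis using N by blast
  qed
  have "openin (top_of_set K) (K \<inter> closure U)"
  proof (subst openin_subopen, intro ballI)
    fix x assume x: "x \<in> K \<inter> closure U"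
    then obtain N where "open N" "x \<in> N" "K \<inter> N \<subseteq> closure U" using nbhd by blast
    then show "\<exists>T. openin (top_of_set K) T \<and> x \<in> T \<and> T \<subseteq> K \<inter> closure U"
      using x by (intro exI[of _ "K \<inter> N"]) auto
  qed
  moreover have "closedin (top_of_set K) (K \<inter> closure U)" by (simp add: closedin_closed_Int)
  moreover have "a \<in> K \<inter> closure U" using K aU closure_subset by blast
  ultimately have "K \<inter> closure U = K" using K(1) unfolding connected_clopen by blast
  then have "b \<in> closure U" using K by blast
  then have "b \<in> U" using low b fb by simp
  with bU show False by simp
qed

section \<open>Functions of class \<open>C\<^sup>1\<close> on the sphere in stereographic charts\<close>

text \<open>
  The chart with pole \<open>- u\<close> is centred at \<open>u\<close>: it maps \<open>0\<close> to \<open>u\<close>, and the differential of its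
  inverse at \<open>u\<close> is half the orthogonal projection onto the tangent space.
\<close>

lemma has_derivative_from_chart:
  fixes f :: "'a::euclidean_space \<Rightarrow> real"
  assumes u: "norm u = 1"
    and D: "((f \<circ> stereo (- u)) has_derivative D) (at 0 within {x. (- u) \<bullet> x = 0})"
  shows "(f has_derivative (\<lambda>h. D ((1/2) *\<^sub>R (h - (u \<bullet> h) *\<^sub>R u)))) (at u within sphere 0 1)"
proof -
  define P where "P = stereo_proj (- u)"
  have uu: "u \<bullet> u = 1" using u by (simp add: norm_eq_1)
  have un: "u \<noteq> - u" using uu by (metis inner_minus_left equal_neg_zero zero_neq_one)
  have P0: "P u = 0" using uu by (simp add: P_def stereo_proj_def)
  have 1: "(P has_derivative (\<lambda>h. (1/2) *\<^sub>R (h - (u \<bullet> h) *\<^sub>R u))) (at u within sphere 0 1 - {- u})"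
    unfolding P_def stereo_proj_def using uu
    by (auto intro!: derivative_eq_intros)
  have img: "P ` (sphere 0 1 - {- u}) \<subseteq> {x. (- u) \<bullet> x = 0}"
    using u stereo_stereo_proj(2)[of "- u"] by (auto simp: P_def)
  have "((f \<circ> stereo (- u)) has_derivative D) (at (P u) within P ` (sphere 0 1 - {- u}))"
    using has_derivative_subset[OF D img] P0 by simp
  from diff_chain_within[OF 1 this]
  have "((f \<circ> stereo (- u) \<circ> P) has_derivative (\<lambda>h. D ((1/2) *\<^sub>R (h - (u \<bullet> h) *\<^sub>R u))))
      (at u within sphere 0 1 - {- u})"
    by (simp add: o_def)
  then have "(f has_derivative (\<lambda>h. D ((1/2) *\<^sub>R (h - (u \<bullet> h) *\<^sub>R u)))) (at u within sphere 0 1 - {- u})"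
  proof (rule has_derivative_transform[rotated 2])
    show "u \<in> sphere 0 1 - {- u}" using u un by auto
    show "\<And>x. x \<in> sphere 0 1 - {- u} \<Longrightarrow> f x = (f \<circ> stereo (- u) \<circ> P) x"
      using u stereo_stereo_proj(1)[of "- u"] by (auto simp: P_def)
  qed
  moreover have "at u within sphere 0 1 - {- u} = at u within sphere 0 1"
    using un by (intro at_within_nhd[of _ "- {- u}"]) auto
  ultimately show ?thesis by simp
qed

lemma C1_on_sphere_chart:
  fixes f :: "'a::euclidean_space \<Rightarrow> real"
  assumes "C1_on_sphere f" "norm p = 1"
  obtains f' :: "'a \<Rightarrow> 'a \<Rightarrow>\<^sub>L real" where "continuous_on {x. p \<bullet> x = 0} f'"
    "\<And>x. p \<bullet> x = 0 \<Longrightarrow>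
      ((f \<circ> stereo p) has_derivative blinfun_apply (f' x)) (at x within {x. p \<bullet> x = 0})"
  using assms unfolding C1_on_sphere_def by (metis mem_sphere_0)

lemma C1_on_sphere_imp_continuous_on:
  assumes "C1_on_sphere f"
  shows "continuous_on (sphere 0 1) f"
  unfolding continuous_on_eq_continuous_within
proof
  fix u :: 'a assume "u \<in> sphere 0 1"
  then have u: "norm u = 1" by simp
  obtain f' :: "'a \<Rightarrow> 'a \<Rightarrow>\<^sub>L real" where
    "\<And>x. (- u) \<bullet> x = 0 \<Longrightarrow>
      ((f \<circ> stereo (- u)) has_derivative blinfun_apply (f' x)) (at x within {x. (- u) \<bullet> x = 0})"
    using C1_on_sphere_chart[OF assms, of "- u"] u by (metis norm_minus_cancel)
  from has_derivative_from_chart[OF u this[of 0]]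
  show "continuous (at u within sphere 0 1) f" by (simp add: has_derivative_continuous)
qed

lemma C1_on_sphere_uminus:
  assumes "C1_on_sphere f"
  shows "C1_on_sphere (\<lambda>x. - f x)"
  unfolding C1_on_sphere_def
proof
  fix p :: 'a assume "p \<in> sphere 0 1"
  then obtain f' :: "'a \<Rightarrow> 'a \<Rightarrow>\<^sub>L real" where f': "continuous_on {x. p \<bullet> x = 0} f'"
    "\<And>x. p \<bullet> x = 0 \<Longrightarrow>
      ((f \<circ> stereo p) has_derivative blinfun_apply (f' x)) (at x within {x. p \<bullet> x = 0})"
    using C1_on_sphere_chart[OF assms, of p] by auto
  show "\<exists>f' :: 'a \<Rightarrow> 'a \<Rightarrow>\<^sub>L real. continuous_on {x. p \<bullet> x = 0} f' \<and>
        (\<forall>x. p \<bullet> x = 0 \<longrightarrow>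
           (((\<lambda>x. - f x) \<circ> stereo p) has_derivative blinfun_apply (f' x)) (at x within {x. p \<bullet> x = 0}))"
  proof (intro exI[of _ "\<lambda>x. - f' x"] conjI allI impI continuous_on_minus f'(1))
    fix x assume "p \<bullet> x = 0"
    moreover have "blinfun_apply (- f' x) = (\<lambda>h. - blinfun_apply (f' x) h)"
      by (simp add: fun_eq_iff blinfun.minus_left)
    ultimately show "((\<lambda>x. - f x) \<circ> stereo p has_derivative blinfun_apply (- f' x))
        (at x within {x. p \<bullet> x = 0})"
      using has_derivative_minus[OF f'(2)] by (simp add: o_def)
  qed
qed

lemma has_sphere_derivative_0_uminus_iff:
  assumes "norm u = 1"
  shows "has_sphere_derivative (\<lambda>x. - f x) (\<lambda>_. 0) u \<longleftrightarrow> has_sphere_derivative f (\<lambda>_. 0) u"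
  unfolding has_sphere_derivative_iff[OF assms]
  using has_derivative_minus[of f "\<lambda>_. 0"] has_derivative_minus[of "\<lambda>x. - f x" "\<lambda>_. 0"] by auto

lemma stereo_minus_at_0: "stereo (- u) 0 = u"
  by (simp add: stereo_def)

lemma continuous_on_stereo: "continuous_on A (stereo p)"
  by (meson continuous_at_imp_continuous_on differentiable_imp_continuous_within stereo_differentiable)

lemma sphere_nbhd_subset_stereo_ball:
  fixes u :: "'a::euclidean_space"
  assumes u: "norm u = 1" and r: "r > 0"
  obtains N where "open N" "u \<in> N"
    "N \<inter> sphere 0 1 \<subseteq> stereo (- u) ` ({x. (- u) \<bullet> x = 0} \<inter> ball 0 r)"
proof -
  have uu: "u \<bullet> u = 1" using u by (simp add: norm_eq_1)
  let ?H = "{y. u \<bullet> y > - 1}"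
  have H: "open ?H" by (rule open_halfspace_gt)
  have c: "continuous_on ?H (stereo_proj (- u))"
    unfolding stereo_proj_def by (auto intro!: continuous_intros)
  define N where "N = ?H \<inter> stereo_proj (- u) -` ball 0 r"
  have "open N" unfolding N_def by (rule continuous_open_preimage[OF c H open_ball])
  moreover have "u \<in> N" using uu r by (simp add: N_def stereo_proj_def)
  moreover have "N \<inter> sphere 0 1 \<subseteq> stereo (- u) ` ({x. (- u) \<bullet> x = 0} \<inter> ball 0 r)"
  proof
    fix y assume y: "y \<in> N \<inter> sphere 0 1"
    then have "y \<noteq> - u" using uu by (auto simp: N_def)
    then have "stereo (- u) (stereo_proj (- u) y) = y" "(- u) \<bullet> stereo_proj (- u) y = 0"
      using stereo_stereo_proj[of "- u" y] u y by auto
    then show "y \<in> stereo (- u) ` ({x. (- u) \<bullet> x = 0} \<inter> ball 0 r)"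
      using y unfolding N_def by (intro image_eqI[of _ _ "stereo_proj (- u) y"]) auto
  qed
  ultimately show thesis using that by blast
qed

section \<open>Sublevel sets near a noncritical point\<close>

text \<open>
  The derivative of \<open>f\<close> in the chart is nonzero at \<open>0\<close>, so it is negative on some tangent vector \<open>v\<close>.
  By continuity of the derivative it is negative on the same \<open>v\<close> at all points of a ball, and the
  mean value theorem applies to every segment in the direction \<open>v\<close> in this ball. This is the
  only place where \<open>C\<^sup>1\<close> is used rather than differentiability.
\<close>

lemma noncritical_descent_direction:
  fixes f :: "'a::euclidean_space \<Rightarrow> real"
  assumes C1: "C1_on_sphere f" and u: "norm u = 1" and nc: "\<not> has_sphere_derivative f (\<lambda>_. 0) u"
  obtains v r where "(- u) \<bullet> v = 0" "r > 0"
    "\<And>x s. (- u) \<bullet> x = 0 \<Longrightarrow> s > 0 \<Longrightarrow> norm x < r \<Longrightarrow> norm (x + s *\<^sub>R v) < r \<Longrightarrow>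
       f (stereo (- u) (x + s *\<^sub>R v)) < f (stereo (- u) x)"
proof -
  let ?T = "{x. (- u) \<bullet> x = 0}"
  obtain f' :: "'a \<Rightarrow> 'a \<Rightarrow>\<^sub>L real" where f'c: "continuous_on ?T f'" and
    f': "\<And>x. (- u) \<bullet> x = 0 \<Longrightarrow>
      ((f \<circ> stereo (- u)) has_derivative blinfun_apply (f' x)) (at x within ?T)"
    using C1_on_sphere_chart[OF C1, of "- u"] u by (metis norm_minus_cancel)
  have uu: "u \<bullet> u = 1" using u by (simp add: norm_eq_1)
  have "(f has_derivative (\<lambda>h. f' 0 ((1/2) *\<^sub>R (h - (u \<bullet> h) *\<^sub>R u)))) (at u within sphere 0 1)"
    using has_derivative_from_chart[OF u f'] by simp
  then obtain h where h: "f' 0 ((1/2) *\<^sub>R (h - (u \<bullet> h) *\<^sub>R u)) \<noteq> 0"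
    using nc unfolding has_sphere_derivative_iff[OF u] by (metis (no_types, lifting) ext)
  define w where "w = (1/2) *\<^sub>R (h - (u \<bullet> h) *\<^sub>R u)"
  \<comment> \<open>The hyperplane is symmetric, so the sign of the derivative can be chosen.\<close>
  define v where "v = (if f' 0 w < 0 then w else - w)"
  have "u \<bullet> w = 0" using uu by (simp add: w_def inner_diff_right)
  then have v: "(- u) \<bullet> v = 0" by (simp add: v_def)
  have v0: "f' 0 v < 0" using h by (auto simp: v_def w_def[symmetric] blinfun.minus_right)
  have "continuous_on ?T (\<lambda>x. f' x v)" by (intro continuous_intros f'c)
  then have "continuous (at 0 within ?T) (\<lambda>x. f' x v)"
    by (simp add: continuous_on_eq_continuous_within)
  then have "\<forall>\<^sub>F x in at 0 within ?T. f' x v < 0"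
    using v0 by (simp add: continuous_within order_tendstoD)
  then obtain r where r: "r > 0" "\<forall>x\<in>?T. x \<noteq> 0 \<and> dist x 0 < r \<longrightarrow> f' x v < 0"
    unfolding eventually_at by blast
  have neg: "f' x v < 0" if "(- u) \<bullet> x = 0" "norm x < r" for x
    using r v0 that by (cases "x = 0") auto
  have "f (stereo (- u) (x + s *\<^sub>R v)) < f (stereo (- u) x)"
    if x: "(- u) \<bullet> x = 0" "norm x < r" and s: "s > 0" "norm (x + s *\<^sub>R v) < r" for x s
  proof -
    let ?g = "f \<circ> stereo (- u)"
    have T: "(- u) \<bullet> (x + t *\<^sub>R v) = 0" for t using x v by (simp add: inner_add_right)
    have nm: "norm (x + t *\<^sub>R v) < r" if t: "0 \<le> t" "t \<le> s" for t
    proof -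
      have "x + t *\<^sub>R v = (1 - t / s) *\<^sub>R x + (t / s) *\<^sub>R (x + s *\<^sub>R v)"
        using s by (simp add: algebra_simps)
      moreover have "(1 - t / s) *\<^sub>R x + (t / s) *\<^sub>R (x + s *\<^sub>R v) \<in> ball 0 r"
        using t s x by (intro convexD[OF convex_ball]) auto
      ultimately show ?thesis by simp
    qed
    have der: "((\<lambda>t. ?g (x + t *\<^sub>R v)) has_derivative (\<lambda>h. f' (x + t *\<^sub>R v) (h *\<^sub>R v))) (at t within {0..s})" for t
    proof -
      have 1: "((\<lambda>t. x + t *\<^sub>R v) has_derivative (\<lambda>h. h *\<^sub>R v)) (at t within {0..s})"
        by (auto intro!: derivative_eq_intros)
      have sub: "(\<lambda>t. x + t *\<^sub>R v) ` {0..s} \<subseteq> ?T" using T by auto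
      show ?thesis
        using diff_chain_within[OF 1 has_derivative_subset[OF f'[OF T] sub]] by (simp add: o_def)
    qed
    obtain t where t: "t \<in> {0<..<s}" "?g (x + s *\<^sub>R v) - ?g (x + 0 *\<^sub>R v) = f' (x + t *\<^sub>R v) ((s - 0) *\<^sub>R v)"
      using mvt_simple[OF s(1), of "\<lambda>t. ?g (x + t *\<^sub>R v)" "\<lambda>t h. f' (x + t *\<^sub>R v) (h *\<^sub>R v)"] der by blast
    have "f' (x + t *\<^sub>R v) v < 0" using neg[OF T nm] t by simp
    then have "s * f' (x + t *\<^sub>R v) v < 0" using s by (simp add: mult_pos_neg)
    then show ?thesis using t by (simp add: blinfun.scaleR_right)
  qed
  then show thesis using that v r by blast
qed

lemma noncritical_in_closure_sublevel:
  fixes f :: "'a::euclidean_space \<Rightarrow> real"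
  assumes C1: "C1_on_sphere f" and u: "norm u = 1" and nc: "\<not> has_sphere_derivative f (\<lambda>_. 0) u"
  shows "u \<in> closure {y \<in> sphere 0 1. f y < f u}"
proof -
  obtain v r where v: "(- u) \<bullet> v = 0" "r > 0" and
    d: "\<And>x s. (- u) \<bullet> x = 0 \<Longrightarrow> s > 0 \<Longrightarrow> norm x < r \<Longrightarrow> norm (x + s *\<^sub>R v) < r \<Longrightarrow>
       f (stereo (- u) (x + s *\<^sub>R v)) < f (stereo (- u) x)"
    using noncritical_descent_direction[OF assms] by blast
  define y where "y s = stereo (- u) (s *\<^sub>R v)" for s
  have lim: "((\<lambda>s. s *\<^sub>R v) \<longlongrightarrow> 0 *\<^sub>R v) (at_right 0)" by (intro tendsto_intros)
  have "isCont (stereo (- u)) 0" by (simp add: differentiable_imp_continuous_within stereo_differentiable)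
  then have "(y \<longlongrightarrow> u) (at_right 0)"
    unfolding y_def using isCont_tendsto_compose[OF _ lim, of "stereo (- u)"] by (simp add: stereo_minus_at_0)
  moreover have "\<forall>\<^sub>F s in at_right 0. norm (s *\<^sub>R v) < r"
    using order_tendstoD(2)[OF tendsto_norm[OF lim], of r] v by simp
  then have "\<forall>\<^sub>F s in at_right 0. y s \<in> {y \<in> sphere 0 1. f y < f u}"
    using eventually_at_right_less[of 0]
  proof eventually_elim
    case (elim s)
    have "norm (y s) = 1" unfolding y_def using v u by (intro norm_stereo) auto
    moreover have "f (y s) < f u"
      using d[of 0 s] elim v by (simp add: y_def stereo_minus_at_0)
    ultimately show ?case by simp
  qed
  ultimately show ?thesis
    using Lim_in_closed_set[OF closed_closure] closure_subset
    by (smt (verit, ccfv_SIG) eventually_mono subset_iff trivial_limit_at_right_real)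
qed

text \<open>
  In the chart, follow the descent direction \<open>v\<close> for a fixed time \<open>s\<close>. The end point \<open>s v\<close> of the
  segment from \<open>0\<close> has a value below \<open>f u\<close>, hence so does a whole convex neighbourhood \<open>P\<close> of it. A
  point \<open>y\<close> near \<open>0\<close> with value below \<open>f u\<close> flows into \<open>P\<close> without leaving \<open>{f < f u}\<close>, so all
  such \<open>y\<close> lie in the component of \<open>s v\<close>.
\<close>

lemma noncritical_sublevel_locally_connected:
  fixes f :: "'a::euclidean_space \<Rightarrow> real"
  assumes C1: "C1_on_sphere f" and u: "norm u = 1" and nc: "\<not> has_sphere_derivative f (\<lambda>_. 0) u"
  obtains N C where "open N" "u \<in> N" "connected C" "C \<subseteq> {y \<in> sphere 0 1. f y < f u}"
    "N \<inter> {y \<in> sphere 0 1. f y < f u} \<subseteq> C"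
proof -
  let ?T = "{x. (- u) \<bullet> x = 0}"
  let ?g = "\<lambda>x. f (stereo (- u) x)"
  let ?L = "{x \<in> ?T. ?g x < f u}"
  obtain v r where v: "(- u) \<bullet> v = 0" and r: "r > 0" and
    d: "\<And>x s. (- u) \<bullet> x = 0 \<Longrightarrow> s > 0 \<Longrightarrow> norm x < r \<Longrightarrow> norm (x + s *\<^sub>R v) < r \<Longrightarrow>
       ?g (x + s *\<^sub>R v) < ?g x"
    using noncritical_descent_direction[OF assms] by blast
  \<comment> \<open>This \<open>s\<close> keeps points of the ball of radius \<open>r / 2\<close> inside the ball of radius \<open>r\<close>;
    the summand 1 only spares a separate treatment of \<open>v = 0\<close>.\<close>
  define s where "s = r / (2 * (norm v + 1))"
  have v1: "norm v + 1 > 0" by (simp add: add_nonneg_pos)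
  then have s: "s > 0" using r by (simp add: s_def)
  have "s * norm v < s * (norm v + 1)" using s by simp
  also have "\<dots> = r / 2" unfolding s_def using v1
    by (metis nonzero_mult_div_cancel_right times_divide_eq_left mult_divide_mult_cancel_right order_less_irrefl)
  finally have sv: "s * norm v < r / 2" .
  have st: "stereo (- u) ` ?T \<subseteq> sphere 0 1" using u norm_stereo[of "- u"] by auto
  have gc: "continuous_on ?T ?g"
    using continuous_on_compose2[OF C1_on_sphere_imp_continuous_on[OF C1] continuous_on_stereo st] .
  have svT: "s *\<^sub>R v \<in> ?T" using v by simp
  have svL: "?g (s *\<^sub>R v) < f u"
    using d[of 0 s] s sv r by (simp add: stereo_minus_at_0)
  have "\<forall>\<^sub>F x in at (s *\<^sub>R v) within ?T. ?g x < f u"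
  proof (rule order_tendstoD(2)[OF _ svL])
    show "(?g \<longlongrightarrow> ?g (s *\<^sub>R v)) (at (s *\<^sub>R v) within ?T)"
      using gc svT unfolding continuous_on_def by blast
  qed
  then obtain \<rho> where \<rho>: "\<rho> > 0" "\<forall>x\<in>?T. x \<noteq> s *\<^sub>R v \<and> dist x (s *\<^sub>R v) < \<rho> \<longrightarrow> ?g x < f u"
    unfolding eventually_at by blast
  let ?P = "?T \<inter> ball (s *\<^sub>R v) \<rho>"
  have PL: "?P \<subseteq> ?L"
  proof
    fix x assume "x \<in> ?P"
    then show "x \<in> ?L" using \<rho> svL by (cases "x = s *\<^sub>R v") (auto simp: dist_commute)
  qed
  have Tc: "convex ?T" by (rule convex_hyperplane)
  have Pc: "connected ?P" by (intro convex_connected convex_Int Tc convex_ball)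
  define C where "C = connected_component_set ?L (s *\<^sub>R v)"
  have key: "y \<in> C" if y: "y \<in> ?L" "norm y < min \<rho> (r / 2)" for y
  proof -
    let ?Q = "(\<lambda>t. y + t *\<^sub>R v) ` {0..s}"
    have QT: "(- u) \<bullet> (y + t *\<^sub>R v) = 0" for t using y v by (simp add: inner_add_right)
    have "connected ?Q" by (intro connected_continuous_image continuous_intros) simp
    moreover have "y + s *\<^sub>R v \<in> ?P" using QT[of s] y by (simp add: dist_norm)
    moreover have "y + s *\<^sub>R v \<in> ?Q" using s by auto
    ultimately have con: "connected (?P \<union> ?Q)" by (intro connected_Un Pc) blast+
    have "?g (y + t *\<^sub>R v) < f u" if t: "t \<in> {0..s}" for t
    proof (cases "t = 0")
      case False
      have "norm (y + t *\<^sub>R v) \<le> norm y + t * norm v" using norm_triangle_ineq[of y "t *\<^sub>R v"] t by simp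
      also have "\<dots> \<le> norm y + s * norm v" using t by (simp add: mult_right_mono)
      also have "\<dots> < r" using y sv by simp
      finally show ?thesis using d[of y t] False t y r by force
    qed (use y in simp)
    then have "?P \<union> ?Q \<subseteq> ?L" using PL QT by auto
    moreover have "s *\<^sub>R v \<in> ?P" using svT \<rho> by simp
    ultimately have "?P \<union> ?Q \<subseteq> C" unfolding C_def using con by (intro connected_component_maximal) blast+
    moreover have "y \<in> ?Q" using s by (intro image_eqI[of _ _ 0]) auto
    ultimately show ?thesis by blast
  qed
  have CL: "C \<subseteq> ?L" unfolding C_def by (rule connected_component_subset)
  obtain N where N: "open N" "u \<in> N" "N \<inter> sphere 0 1 \<subseteq> stereo (- u) ` (?T \<inter> ball 0 (min \<rho> (r / 2)))"
    using sphere_nbhd_subset_stereo_ball[OF u, of "min \<rho> (r / 2)"] \<rho> r by auto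
  show thesis
  proof (rule that[OF N(1,2), of "stereo (- u) ` C"])
    show "connected (stereo (- u) ` C)"
      by (intro connected_continuous_image continuous_on_stereo) (simp add: C_def)
    show "stereo (- u) ` C \<subseteq> {y \<in> sphere 0 1. f y < f u}" using CL st by blast
    show "N \<inter> {y \<in> sphere 0 1. f y < f u} \<subseteq> stereo (- u) ` C"
    proof
      fix z assume z: "z \<in> N \<inter> {y \<in> sphere 0 1. f y < f u}"
      then obtain y where y: "y \<in> ?T" "norm y < min \<rho> (r / 2)" "z = stereo (- u) y"
        using N(3) by (auto simp: subset_iff image_iff)
      then have "y \<in> ?L" using z by simp
      then show "z \<in> stereo (- u) ` C" using key y by blast
    qed
  qed
qed

section \<open>Punctured neighbourhoods on the sphere\<close>

text \<open>
  In the chart the punctured neighbourhood is a ball of a hyperplane of dimension at least two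
  without its centre, and a convex set that does not lie on a line stays connected
  when a point is removed.
\<close>

lemma sphere_punctured_nbhd:
  fixes u :: "'a::euclidean_space"
  assumes dim: "DIM('a) \<ge> 3" and u: "norm u = 1" and W: "open W" "u \<in> W"
  obtains N C where "open N" "u \<in> N" "connected C" "u \<in> closure C"
    "N \<inter> sphere 0 1 - {u} \<subseteq> C" "C \<subseteq> W \<inter> sphere 0 1 - {u}"
proof -
  let ?T = "{x. (- u) \<bullet> x = 0}"
  have u0: "- u \<noteq> 0" using u by auto
  have st: "stereo (- u) ` ?T \<subseteq> sphere 0 1" using u norm_stereo[of "- u"] by auto
  have "open (stereo (- u) -` W)"
    using continuous_open_preimage[OF continuous_on_stereo[of UNIV] _ W(1)] by simp
  then obtain r where r: "r > 0" "ball 0 r \<subseteq> stereo (- u) -` W"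
    using W(2) stereo_minus_at_0[of u] by (metis open_contains_ball vimageI)
  let ?B = "?T \<inter> ball 0 r"
  have Tc: "convex ?T" by (rule convex_hyperplane)
  then have Bc: "convex ?B" by (intro convex_Int convex_ball)
  have sub: "subspace ?T" by (rule subspace_hyperplane)
  have "aff_dim ?B = aff_dim ?T"
  proof (intro aff_dim_convex_Int_open Tc open_ball)
    have "0 \<in> ?B" using r by simp
    then show "?B \<noteq> {}" by blast
  qed
  also have "\<dots> = int (DIM('a) - 1)"
    using aff_dim_subspace[OF sub] dim_hyperplane[OF u0] by simp
  finally have nc: "\<not> collinear ?B" using dim by (simp add: collinear_aff_dim)
  have con: "connected (?B - {0})"
    by (rule connected_convex_diff_countable[OF Bc nc]) simp
  have "0 islimpt ?B"
  proof (rule connected_imp_perfect)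
    show "connected ?B" by (rule convex_connected[OF Bc])
    show "0 \<in> ?B" using r by simp
    show "?B \<noteq> {x}" for x using nc by auto
  qed
  then have cl: "0 \<in> closure (?B - {0})" by (simp add: islimpt_in_closure)
  obtain N where N: "open N" "u \<in> N" "N \<inter> sphere 0 1 \<subseteq> stereo (- u) ` ?B"
    using sphere_nbhd_subset_stereo_ball[OF u r(1)] by blast
  show thesis
  proof (rule that[OF N(1,2), of "stereo (- u) ` (?B - {0})"])
    show "connected (stereo (- u) ` (?B - {0}))"
      by (intro connected_continuous_image continuous_on_stereo con)
    have "stereo (- u) 0 \<in> closure (stereo (- u) ` (?B - {0}))"
      using image_closure_subset[OF continuous_on_stereo closed_closure closure_subset] cl by blast
    then show "u \<in> closure (stereo (- u) ` (?B - {0}))" by (simp add: stereo_minus_at_0)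
    show "N \<inter> sphere 0 1 - {u} \<subseteq> stereo (- u) ` (?B - {0})"
      using N(3) stereo_minus_at_0[of u] by blast
    have inj: "inj_on (stereo (- u)) ?T" using bij_betw_stereo[of "- u"] u by (auto simp: bij_betw_def)
    have "stereo (- u) x \<noteq> u" if "x \<in> ?B - {0}" for x
      using that inj_onD[OF inj, of x 0] stereo_minus_at_0[of u] by auto
    then have "stereo (- u) x \<in> W \<inter> sphere 0 1 - {u}" if "x \<in> ?B - {0}" for x
      using that subsetD[OF r(2), of x] subsetD[OF st imageI, of x] by simp
    then show "stereo (- u) ` (?B - {0}) \<subseteq> W \<inter> sphere 0 1 - {u}" by (rule image_subsetI)
  qed
qed

section \<open>Two local minima force a further critical point\<close>

lemma local_min_on_iff_nbhd:
  "local_min_on S f u \<longleftrightarrow> u \<in> S \<and> (\<exists>N. open N \<and> u \<in> N \<and> (\<forall>y \<in> N \<inter> S. f u \<le> f y))"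
proof -
  have "(y \<noteq> u \<longrightarrow> y \<in> S \<longrightarrow> f u \<le> f y) \<longleftrightarrow> (y \<in> S \<longrightarrow> f u \<le> f y)" for y
    by (cases "y = u") simp_all
  then show ?thesis
    unfolding local_min_on_def eventually_at_topological Ball_def Int_iff by (simp add: imp_conjL)
qed

lemma local_max_on_eq_local_min_on_uminus:
  "local_max_on S f u \<longleftrightarrow> local_min_on S (\<lambda>x. - f x) u"
  by (simp add: local_max_on_def local_min_on_def)

text \<open>
  A nearby point \<open>y\<close> with \<open>f y = f u\<close> outside \<open>M\<close> would be noncritical, so \<open>f\<close> would take values
  below \<open>f u\<close> close to \<open>y\<close>, hence close to \<open>u\<close>.
\<close>

lemma local_min_strict_if_isolated:
  fixes f :: "'a::euclidean_space \<Rightarrow> real"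
  assumes C1: "C1_on_sphere f" and M: "finite M"
    and crit: "\<And>u. u \<in> sphere 0 1 - M \<Longrightarrow> \<not> has_sphere_derivative f (\<lambda>_. 0) u"
    and u: "local_min_on (sphere 0 1) f u"
  shows "strict_local_min_on (sphere 0 1) f u"
proof -
  obtain N where N: "open N" "u \<in> N" "\<forall>y \<in> N \<inter> sphere 0 1. f u \<le> f y"
    using u unfolding local_min_on_iff_nbhd by blast
  let ?N = "N - (M - {u})"
  have "f u < f y" if y: "y \<in> ?N \<inter> sphere 0 1" "y \<noteq> u" for y
  proof (rule ccontr)
    assume "\<not> f u < f y"
    then have le: "f y \<le> f u" by simp
    have "\<not> has_sphere_derivative f (\<lambda>_. 0) y" using y by (intro crit) auto
    then have "y \<in> closure {z \<in> sphere 0 1. f z < f y}"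
      using noncritical_in_closure_sublevel[OF C1] y by simp
    then have "N \<inter> {z \<in> sphere 0 1. f z < f y} \<noteq> {}"
      using y N(1) open_Int_closure_eq_empty[OF N(1)] by blast
    then show False using N(3) le by force
  qed
  moreover have "open ?N" using N M by (intro open_Diff finite_imp_closed) auto
  ultimately show ?thesis using N unfolding strict_local_min_on_def by blast
qed

text \<open>
  Without critical points outside \<open>M\<close>, every point of the sphere is noncritical, a strict local
  maximum or a strict local minimum. Points of the first two kinds leave the sublevel set
  unsplit, so \<open>mountain_pass\<close> allows only one strict local minimum.
\<close>

lemma two_local_minima_imp_critical_point:
  fixes f :: "'a::euclidean_space \<Rightarrow> real"
  assumes dim: "DIM('a) \<ge> 3" and C1: "C1_on_sphere f" and M: "finite M"
    and ext: "\<And>u. u \<in> M \<Longrightarrow> local_min_on (sphere 0 1) f u \<or> local_max_on (sphere 0 1) f u"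
    and ab: "local_min_on (sphere 0 1) f a" "local_min_on (sphere 0 1) f b" "a \<noteq> b"
  shows "\<exists>u \<in> sphere 0 1 - M. has_sphere_derivative f (\<lambda>_. 0) u"
proof (rule ccontr)
  assume "\<not> ?thesis"
  then have crit: "\<not> has_sphere_derivative f (\<lambda>_. 0) u" if "u \<in> sphere 0 1 - M" for u
    using that by blast
  have strict: "strict_local_min_on (sphere 0 1) f u" if "local_min_on (sphere 0 1) f u" for u
    by (rule local_min_strict_if_isolated[OF C1 M crit that])
  have "strict_local_min_on (sphere 0 1) f x \<or> sublevel_unsplit_at (sphere 0 1) f x"
    if xS: "x \<in> sphere 0 1" for x
  proof (cases "x \<in> M")
    case False
    have x: "norm x = 1" using xS by simp
    have ncx: "\<not> has_sphere_derivative f (\<lambda>_. 0) x" using False xS by (intro crit) auto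
    obtain N C where N: "open N" "x \<in> N" and C: "connected C" "C \<subseteq> {y \<in> sphere 0 1. f y < f x}"
      "N \<inter> {y \<in> sphere 0 1. f y < f x} \<subseteq> C"
      using noncritical_sublevel_locally_connected[OF C1 x ncx] by blast
    \<comment> \<open>Without \<open>M\<close> all points of the neighbourhood are noncritical.\<close>
    have "(N - M) \<inter> {y \<in> sphere 0 1. f y \<le> f x} \<subseteq> closure {y \<in> sphere 0 1. f y < f x}"
    proof
      fix y assume y: "y \<in> (N - M) \<inter> {y \<in> sphere 0 1. f y \<le> f x}"
      then have "y \<in> closure {z \<in> sphere 0 1. f z < f y}"
        by (intro noncritical_in_closure_sublevel[OF C1] crit) auto
      also have "\<dots> \<subseteq> closure {z \<in> sphere 0 1. f z < f x}" using y by (intro closure_mono) auto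
      finally show "y \<in> closure {z \<in> sphere 0 1. f z < f x}" .
    qed
    moreover have "open (N - M)" using N M by (intro open_Diff finite_imp_closed) auto
    moreover have "x \<in> N - M" using N False by blast
    ultimately show ?thesis using C unfolding sublevel_unsplit_at_def by blast
  next
    case True
    show ?thesis
    proof (cases "local_min_on (sphere 0 1) f x")
      case False
      then have "local_min_on (sphere 0 1) (\<lambda>x. - f x) x"
        using True ext by (auto simp: local_max_on_eq_local_min_on_uminus)
      then have "strict_local_min_on (sphere 0 1) (\<lambda>x. - f x) x"
        using crit has_sphere_derivative_0_uminus_iff[of _ f]
        by (intro local_min_strict_if_isolated[OF C1_on_sphere_uminus[OF C1] M]) auto
      then obtain W where W: "open W" "x \<in> W" "\<forall>y \<in> W \<inter> sphere 0 1. y \<noteq> x \<longrightarrow> f y < f x"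
        unfolding strict_local_min_on_def by auto
      obtain N C where N: "open N" "x \<in> N" and C: "connected C" "x \<in> closure C"
        "N \<inter> sphere 0 1 - {x} \<subseteq> C" "C \<subseteq> W \<inter> sphere 0 1 - {x}"
        using sphere_punctured_nbhd[OF dim _ W(1,2)] xS by auto
      have CL: "C \<subseteq> {y \<in> sphere 0 1. f y < f x}" using C(4) W(3) by blast
      have "N \<inter> {y \<in> sphere 0 1. f y < f x} \<subseteq> C" using C(3) by blast
      moreover have "N \<inter> {y \<in> sphere 0 1. f y \<le> f x} \<subseteq> closure C"
        using C(2,3) closure_subset[of C] by blast
      then have "N \<inter> {y \<in> sphere 0 1. f y \<le> f x} \<subseteq> closure {y \<in> sphere 0 1. f y < f x}"
        using closure_mono[OF CL] by blast
      ultimately show ?thesis using N C(1) CL unfolding sublevel_unsplit_at_def by blast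
    qed (use strict in blast)
  qed
  moreover have "connected (sphere (0::'a) 1)" using dim by (intro connected_sphere) simp
  ultimately have "a = b"
    using ab strict
    by (intro mountain_pass[of "sphere 0 1" f] C1_on_sphere_imp_continuous_on[OF C1]
        locally_path_connected_sphere) (auto simp: local_min_on_def)
  with ab show False by simp
qed

theorem proposition12:
  fixes f :: "'a::euclidean_space \<Rightarrow> real" and m :: "nat \<Rightarrow> 'a" and n k :: nat
  assumes "n \<ge> 2" and "DIM('a) = n + 1"
    and "C1_on_sphere f"
    and "k \<ge> 3"
    and "\<And>i. i \<in> {1..k} \<Longrightarrow> m i \<in> sphere 0 1"
    and "inj_on m {1..k}"
    and "\<And>i. i \<in> {1..k} \<Longrightarrow>
           local_min_on (sphere 0 1) f (m i) \<or> local_max_on (sphere 0 1) f (m i)"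
  shows "\<exists>u \<in> sphere 0 1. (\<forall>i \<in> {1..k}. u \<noteq> m i) \<and> has_sphere_derivative f (\<lambda>_. 0) u"
proof -
  let ?M = "m ` {1..k}"
  let ?min = "local_min_on (sphere 0 1)"
  have dim: "DIM('a) \<ge> 3" using assms by simp
  have fin: "finite ?M" by simp
  have ext: "?min f u \<or> ?min (\<lambda>x. - f x) u" if "u \<in> ?M" for u
    using that assms(7) unfolding local_max_on_eq_local_min_on_uminus by blast
  have "\<exists>u \<in> sphere 0 1 - ?M. has_sphere_derivative f (\<lambda>_. 0) u"
  proof (cases "\<exists>i\<in>{1..k}. \<exists>j\<in>{1..k}. m i \<noteq> m j \<and> ?min f (m i) \<and> ?min f (m j)")
    case True
    then obtain i j where "m i \<noteq> m j" "?min f (m i)" "?min f (m j)" by blast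
    then show ?thesis
      using two_local_minima_imp_critical_point[OF dim assms(3) fin, of "m i" "m j"] ext
      by (auto simp: local_max_on_eq_local_min_on_uminus)
  next
    case False
    \<comment> \<open>At most one of three points is a minimum, so two of them are maxima.\<close>
    have d: "m 1 \<noteq> m 2" "m 1 \<noteq> m 3" "m 2 \<noteq> m 3"
      using assms(4) inj_onD[OF assms(6)] by fastforce+
    have "\<exists>i\<in>{1..k}. \<exists>j\<in>{1..k}. m i \<noteq> m j \<and> ?min (\<lambda>x. - f x) (m i) \<and> ?min (\<lambda>x. - f x) (m j)"
    proof -
      have i: "1 \<in> {1..k}" "2 \<in> {1..k}" "3 \<in> {1..k}" using assms(4) by auto
      then show ?thesis using False d ext by (metis imageI)
    qed
    then obtain i j where "m i \<noteq> m j" "?min (\<lambda>x. - f x) (m i)" "?min (\<lambda>x. - f x) (m j)" by blast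
    then have "\<exists>u \<in> sphere 0 1 - ?M. has_sphere_derivative (\<lambda>x. - f x) (\<lambda>_. 0) u"
      using ext
      by (intro two_local_minima_imp_critical_point[OF dim C1_on_sphere_uminus[OF assms(3)] fin])
        (auto simp: local_max_on_eq_local_min_on_uminus)
    then show ?thesis using has_sphere_derivative_0_uminus_iff[of _ f] by auto
  qed
  then show ?thesis by blast
qed

end
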